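(* Let $X$ be a nonempty set equipped with a separated uniformity $\mathscr U$ generated by a nonempty family $\mathscr F$ of pseudometrics with associated collection $\mathscr V$ of basic entourages, and let $G$ be a directed graph with $V(G)=X$ and $E(G)\supseteq\Delta(X)$. Let $T:X\to X$ be a Banach $G$-contraction and $x_0\in X$. If $Tx_0\in[x_0]_{\widetilde G}$, then $[x_0]_{\widetilde G}$ is $T$-invariant (i.e. $T([x_0]_{\widetilde G})\subseteq[x_0]_{\widetilde G}$) and $T|_{[x_0]_{\widetilde G}}$ is a Banach $\widetilde G_{x_0}$-contraction. Furthermore, the sequences $\{T^nx\}$ and $\{T^ny\}$ are Cauchy equivalent for all $x,y\in[x_0]_{\widetilde G}$.
   Context: Uniform structure: $\mathscr U$ is a uniformity on $X$; separated means $\bigcap\mathscr U=\Delta(X)=\{(x,x):x\in X\}$. $\mathscr F$ is a nonempty family of (uniformly continuous) pseudometrics on $X$ generating $\mathscr U$. For a pseudometric $\rho$ and $r>0$ put $V(\rho,r)=\{(x,y)\in X\times X:\rho(x,y)<r\}$. $\mathscr V$ is the collection of all sets $\bigcap_{i=1}^m V(\rho_i,r_i)$ with $m\ge1$, $\rho_i\in\mathscr F$, $r_i>0$; it is a base of $\mathscr U$ and its members are called basic entourages. For $V=\bigcap_{i=1}^mV(\rho_i,r_i)\in\mathscr V$ and $\alpha>0$, put $\alpha V=\bigcap_{i=1}^mV(\rho_i,\alpha r_i)$ (a basic entourage is regarded as given together with such a presentation, and $\alpha V$ is formed from it). Graphs: $G$ has vertex set $X$ and edge set $E(G)\subseteq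 X\times X$ (directed, no parallel edges) containing all loops. $\widetilde G$ has vertex set $X$ and $E(\widetilde G)=\{(x,y):(x,y)\in E(G)\text{ or }(y,x)\in E(G)\}$. $[x]_{\widetilde G}$ is the set of all $y\in X$ joined to $x$ by a path in $\widetilde G$, i.e. a finite sequence $x_0'=x,\dots,x_N'=y$ with $(x_{i-1}',x_i')\in E(\widetilde G)$ for $i=1,\dots,N$. $\widetilde G_{x_0}$ is the component of $\widetilde G$ containing $x_0$: the graph with vertex set $[x_0]_{\widetilde G}$ consisting of all edges of $\widetilde G$ contained in a path in $\widetilde G$ starting at $x_0$, so $E(\widetilde G_{x_0})=E(\widetilde G)\cap([x_0]_{\widetilde G}\times[x_0]_{\widetilde G})$. A mapping $T:X\to X$ is a Banach $G$-contraction if (B1) $(x,y)\in E(G)$ implies $(Tx,Ty)\in E(G)$ for all $x,y\in X$; and (B2) there is $\alpha\in(0,1)$ such that $(x,y)\in V\cap E(G)$ implies $(Tx,Ty)\in\alpha V$ for all $x,y\in X$ and all $V\in\mathscr V$. That $T|_{[x_0]_{\widetilde G}}$ is a Banach $\widetilde G_{x_0}$-contraction means that (B1) and (B2) hold with $X$ replaced by $[x_0]_{\widetilde G}$ (with the pseudometrics of $\mathscr F$ restricted to it) and $G$ replaced by $\widetilde G_{x_0}$. Two sequences $\{x_n\}$, $\{y_n\}$ in $X$ are Cauchy equivalent if both are Cauchy and for each $U\in\mathscr U$ there is $N>0$ such that $(x_n,y_n)\in U$ for all $n\ge N$. *)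

theory Defs
  imports Complex_Main
begin

(* The set X is the universe of a type of class uniform_space, which carries an arbitrary
   uniformity in the form of the filter "uniformity". *)

definition entourages :: "('a::uniform_space \<times> 'a) set set" where
  "entourages = {U. eventually (\<lambda>p. p \<in> U) uniformity}"

definition pseudometric :: "('a \<Rightarrow> 'a \<Rightarrow> real) \<Rightarrow> bool" where
  "pseudometric \<rho> \<longleftrightarrow>
     (\<forall>x y. 0 \<le> \<rho> x y) \<and> (\<forall>x. \<rho> x x = 0) \<and> (\<forall>x y. \<rho> x y = \<rho> y x) \<and>
     (\<forall>x y z. \<rho> x z \<le> \<rho> x y + \<rho> y z)"

definition generates_uniformity :: "('a::uniform_space \<Rightarrow> 'a \<Rightarrow> real) set \<Rightarrow> bool" where
  "generates_uniformity F \<longleftrightarrow>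
     (uniformity :: ('a \<times> 'a) filter) =
       (INF \<rho>\<in>F. INF r\<in>{0<..}. principal {(x, y). \<rho> x y < r})"

(* alpha V depends on how V is written as an intersection of the sets V(rho_i, r_i), not only
   on V as a set.  Hence a basic entourage is represented by the list [(rho_1, r_1), ...,
   (rho_m, r_m)], and "entourage C P" is the set presented by P over the carrier C; a
   pseudometric is restricted to C by being evaluated only at points of C. *)

type_synonym 'a presentation = "(('a \<Rightarrow> 'a \<Rightarrow> real) \<times> real) list"

definition presentations :: "('a \<Rightarrow> 'a \<Rightarrow> real) set \<Rightarrow> 'a presentation set" where
  "presentations F = {P. P \<noteq> [] \<and> set P \<subseteq> F \<times> {0<..}}"

definition entourage :: "'a set \<Rightarrow> 'a presentation \<Rightarrow> ('a \<times> 'a) set" where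
  "entourage C P = {(x, y) \<in> C \<times> C. \<forall>(\<rho>, r) \<in> set P. \<rho> x y < r}"

definition scale :: "real \<Rightarrow> 'a presentation \<Rightarrow> 'a presentation" where
  "scale \<alpha> P = map (\<lambda>(\<rho>, r). (\<rho>, \<alpha> * r)) P"

(* A directed graph without parallel edges is given by its vertex set and its edge relation;
   when the vertex set is the whole type, only the relation is mentioned. *)

definition undirected :: "('a \<times> 'a) set \<Rightarrow> ('a \<times> 'a) set" where
  "undirected E = {(x, y). (x, y) \<in> E \<or> (y, x) \<in> E}"

definition joined :: "('a \<times> 'a) set \<Rightarrow> 'a \<Rightarrow> 'a \<Rightarrow> bool" where
  "joined E x y \<longleftrightarrow>
     (\<exists>(p :: nat \<Rightarrow> 'a) N. p 0 = x \<and> p N = y \<and> (\<forall>i\<in>{1..N}. (p (i - 1), p i) \<in> E))"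

definition component :: "('a \<times> 'a) set \<Rightarrow> 'a \<Rightarrow> 'a set" where
  "component E x = {y. joined (undirected E) x y}"

definition component_edges :: "('a \<times> 'a) set \<Rightarrow> 'a \<Rightarrow> ('a \<times> 'a) set" where
  "component_edges E x = undirected E \<inter> (component E x \<times> component E x)"

(* T is a Banach contraction with respect to the graph with vertex set C and edge set E. *)

definition banach_contraction ::
  "('a \<Rightarrow> 'a \<Rightarrow> real) set \<Rightarrow> 'a set \<Rightarrow> ('a \<times> 'a) set \<Rightarrow> ('a \<Rightarrow> 'a) \<Rightarrow> bool" where
  "banach_contraction F C E T \<longleftrightarrow>
     T ` C \<subseteq> C \<and>
     (\<forall>x\<in>C. \<forall>y\<in>C. (x, y) \<in> E \<longrightarrow> (T x, T y) \<in> E) \<and>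
     (\<exists>\<alpha>. 0 < \<alpha> \<and> \<alpha> < 1 \<and>
        (\<forall>x\<in>C. \<forall>y\<in>C. \<forall>P\<in>presentations F.
           (x, y) \<in> entourage C P \<inter> E \<longrightarrow> (T x, T y) \<in> entourage C (scale \<alpha> P)))"

definition cauchy_equivalent :: "(nat \<Rightarrow> 'a::uniform_space) \<Rightarrow> (nat \<Rightarrow> 'a) \<Rightarrow> bool" where
  "cauchy_equivalent x y \<longleftrightarrow>
     Cauchy x \<and> Cauchy y \<and> (\<forall>U\<in>entourages. \<exists>N>0. \<forall>n\<ge>N. (x n, y n) \<in> U)"

end

theory Submission
  imports Defs
begin

text \<open>
  Single-pseudometric entourages turn the contraction condition into
  \<open>\<rho> (T x) (T y) \<le> \<alpha> * \<rho> x y\<close> along edges, in either direction. Summing along a path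
  from \<open>x\<close> to \<open>y\<close> gives \<open>\<rho> (T\<^sup>n x) (T\<^sup>n y) \<le> \<alpha>\<^sup>n * C\<close> with \<open>C\<close> independent of \<open>n\<close>. Since
  \<open>T x\<close> lies in the component of \<open>x\<close>, this applies to \<open>x\<close> and \<open>T x\<close> as well, and a geometric
  series makes the orbit Cauchy.
\<close>

text \<open>Replaces indexed paths by the closure \<open>E\<^sup>*\<close>, so that arguments along
  a path become inductions on \<open>rtrancl\<close>.\<close>

lemma joined_iff_rtrancl: "joined E x y \<longleftrightarrow> (x, y) \<in> E\<^sup>*"
proof
  assume "joined E x y"
  then obtain p :: "nat \<Rightarrow> _" and N
    where p: "p 0 = x" "p N = y" "\<forall>i\<in>{1..N}. (p (i - 1), p i) \<in> E"
    unfolding joined_def by blast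
  have "k \<le> N \<Longrightarrow> (x, p k) \<in> E\<^sup>*" for k
  proof (induction k)
    case 0
    then show ?case using p(1) by simp
  next
    case (Suc k)
    then show ?case using bspec[OF p(3), of "Suc k"] by (auto intro: rtrancl_into_rtrancl)
  qed
  then show "(x, y) \<in> E\<^sup>*" using p(2) by blast
next
  assume "(x, y) \<in> E\<^sup>*"
  then obtain N where "(x, y) \<in> E ^^ N" by (auto dest: rtrancl_imp_relpow)
  then obtain p where p: "p 0 = x" "p N = y" "\<And>i. i < N \<Longrightarrow> (p i, p (Suc i)) \<in> E"
    by (auto simp: relpow_fun_conv)
  \<comment> \<open>A relational power steps from \<open>i\<close> to \<open>Suc i\<close>, whereas
    \<open>joined\<close> steps from \<open>i - 1\<close> to \<open>i\<close>.\<close>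
  have "(p (i - 1), p i) \<in> E" if "i \<in> {1..N}" for i
    using p(3)[of "i - 1"] that by (cases i) auto
  with p show "joined E x y" unfolding joined_def by blast
qed

lemma sym_undirected: "sym (undirected E)"
  by (auto simp: sym_def undirected_def)

lemma mem_component_iff: "y \<in> component E x \<longleftrightarrow> (x, y) \<in> (undirected E)\<^sup>*"
  by (simp add: component_def joined_iff_rtrancl)

text \<open>Walk back from \<open>x\<close> to \<open>z\<close>, then on to \<open>y\<close>; the
  way back exists because \<open>undirected E\<close> is symmetric.\<close>

lemma components_joined:
  assumes "x \<in> component E z" "y \<in> component E z"
  shows "(x, y) \<in> (undirected E)\<^sup>*"
  using symD[OF sym_rtrancl[OF sym_undirected] assms(1)[unfolded mem_component_iff]]
    assms(2)[unfolded mem_component_iff]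
  by (rule rtrancl_trans)

lemma rtrancl_image:
  assumes "\<And>x y. (x, y) \<in> R \<Longrightarrow> (f x, f y) \<in> R" "(x, y) \<in> R\<^sup>*"
  shows "(f x, f y) \<in> R\<^sup>*"
  using assms(2) by induction (auto intro: assms(1) rtrancl_into_rtrancl)

text \<open>The uniformity is an infimum of principal filters, so convergence to it is tested on one
  pseudometric and one radius at a time, without finite intersections.\<close>

lemma generates_uniformity_filterlim_iff:
  assumes "generates_uniformity F"
  shows "filterlim f uniformity A \<longleftrightarrow>
    (\<forall>\<rho>\<in>F. \<forall>r>0. eventually (\<lambda>z. \<rho> (fst (f z)) (snd (f z)) < r) A)"
  unfolding assms[unfolded generates_uniformity_def]
  by (simp add: filterlim_INF filterlim_principal case_prod_beta Ball_def)

text \<open>Being Cauchy means that the pairs \<open>(X n, X m)\<close> converge to the uniformity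
  along the product filter. Symmetry of each \<rho> makes the case \<open>n \<le> m\<close>
  enough.\<close>

lemma CauchyI_pseudometrics:
  assumes "generates_uniformity F" "\<And>\<rho>. \<rho> \<in> F \<Longrightarrow> pseudometric \<rho>"
    and small: "\<And>\<rho> e. \<rho> \<in> F \<Longrightarrow> 0 < e \<Longrightarrow> \<exists>N. \<forall>n m. N \<le> n \<longrightarrow> n \<le> m \<longrightarrow> \<rho> (X n) (X m) < e"
  shows "Cauchy X"
proof -
  have "\<exists>N. \<forall>n\<ge>N. \<forall>m\<ge>N. \<rho> (X n) (X m) < e" if "\<rho> \<in> F" "0 < e" for \<rho> e
  proof -
    have "\<rho> x y = \<rho> y x" for x y
      using assms(2)[OF that(1)] by (auto simp: pseudometric_def)
    then show ?thesis using small[OF that] by (metis nat_le_linear)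
  qed
  then have lim: "filterlim (\<lambda>(n, m). (X n, X m)) uniformity (sequentially \<times>\<^sub>F sequentially)"
    unfolding generates_uniformity_filterlim_iff[OF assms(1)] eventually_prod_sequentially
    by fastforce
  have "eventually (\<lambda>(n, m). P (X n, X m)) (sequentially \<times>\<^sub>F sequentially)"
    if "eventually P uniformity" for P
    using lim[unfolded filterlim_iff, rule_format, OF that] by (simp add: case_prod_unfold)
  then show ?thesis
    unfolding Cauchy_uniform_iff eventually_prod_sequentially by fastforce
qed

lemma geometric_steps_bound:
  assumes "pseudometric \<rho>" "0 < \<alpha>" "\<alpha> < 1" "0 \<le> c"
    and step: "\<And>n. \<rho> (X n) (X (Suc n)) \<le> \<alpha> ^ n * c"
    and "n \<le> m"
  shows "\<rho> (X n) (X m) \<le> \<alpha> ^ n * (c / (1 - \<alpha>))"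
proof -
  have tri: "\<rho> u w \<le> \<rho> u v + \<rho> v w" and refl: "\<rho> u u = 0" for u v w
    using assms(1) unfolding pseudometric_def by blast+
  \<comment> \<open>The exact value of the finite geometric sum is kept: the subtracted
    \<open>\<alpha> ^ m\<close> is what lets the induction absorb the next step.\<close>
  have "\<rho> (X n) (X m) \<le> (\<alpha> ^ n - \<alpha> ^ m) * (c / (1 - \<alpha>))"
    using \<open>n \<le> m\<close>
  proof (induction m rule: dec_induct)
    case base
    then show ?case by (simp add: refl)
  next
    case (step m)
    have "\<rho> (X n) (X (Suc m)) \<le> (\<alpha> ^ n - \<alpha> ^ m) * (c / (1 - \<alpha>)) + \<alpha> ^ m * c"
      using tri[where u = "X n" and v = "X m" and w = "X (Suc m)"] step.IH assms(5)[of m]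
      by linarith
    also have "\<dots> = (\<alpha> ^ n - \<alpha> ^ Suc m) * (c / (1 - \<alpha>))"
      using \<open>\<alpha> < 1\<close> by (simp add: field_simps)
    finally show ?case .
  qed
  also have "\<dots> \<le> \<alpha> ^ n * (c / (1 - \<alpha>))"
    using assms(2-4) by (intro mult_right_mono) auto
  finally show ?thesis .
qed

lemma cauchy_equivalentI:
  assumes "Cauchy X" "Cauchy Y"
    and "filterlim (\<lambda>n. (X n, Y n)) uniformity sequentially"
  shows "cauchy_equivalent X Y"
proof -
  have "\<exists>N>0. \<forall>n\<ge>N. (X n, Y n) \<in> U" if "U \<in> entourages" for U
  proof -
    have "eventually (\<lambda>n. (X n, Y n) \<in> U) sequentially"
      using assms(3)[unfolded filterlim_iff, rule_format, of "\<lambda>p. p \<in> U"] that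
      by (simp add: entourages_def)
    then obtain N where "\<forall>n\<ge>N. (X n, Y n) \<in> U" unfolding eventually_sequentially by blast
    \<comment> \<open>\<open>Suc N\<close> meets the demand for a positive index.\<close>
    then show ?thesis by (intro exI[of _ "Suc N"]) auto
  qed
  with assms(1,2) show ?thesis by (simp add: cauchy_equivalent_def)
qed

lemma banach_contraction_pseudometric:
  assumes "\<forall>\<rho>\<in>F. pseudometric \<rho>"
    and "banach_contraction F UNIV E T"
  obtains \<alpha> where "0 < \<alpha>" "\<alpha> < 1"
    "\<And>\<rho> x y. \<rho> \<in> F \<Longrightarrow> (x, y) \<in> undirected E \<Longrightarrow> \<rho> (T x) (T y) \<le> \<alpha> * \<rho> x y"
proof -
  obtain \<alpha> where \<alpha>: "0 < \<alpha>" "\<alpha> < 1"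
    and contr: "\<And>x y P. P \<in> presentations F \<Longrightarrow> (x, y) \<in> entourage UNIV P \<inter> E \<Longrightarrow>
      (T x, T y) \<in> entourage UNIV (scale \<alpha> P)"
    using assms(2) unfolding banach_contraction_def by auto
  have edge: "\<rho> (T x) (T y) \<le> \<alpha> * \<rho> x y" if "\<rho> \<in> F" "(x, y) \<in> E" for \<rho> x y
  proof -
    \<comment> \<open>A radius must be positive while \<open>\<rho> x y\<close> may be 0, so all
      \<open>r\<close> above \<open>\<rho> x y\<close> are used; letting \<open>r\<close> decrease
      to it gives the non-strict bound.\<close>
    have "\<rho> (T x) (T y) < \<alpha> * r" if "\<rho> x y < r" for r
    proof -
      have "0 < r" using that bspec[OF assms(1) \<open>\<rho> \<in> F\<close>] unfolding pseudometric_def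
        by (meson order_le_less_trans)
      then have "[(\<rho>, r)] \<in> presentations F" using \<open>\<rho> \<in> F\<close> by (simp add: presentations_def)
      from contr[OF this, of x y] show ?thesis
        using that \<open>(x, y) \<in> E\<close> by (simp add: entourage_def scale_def)
    qed
    then have "\<rho> (T x) (T y) / \<alpha> < r" if "\<rho> x y < r" for r
      using that \<open>0 < \<alpha>\<close> by (metis pos_divide_less_eq mult.commute)
    then have "\<rho> (T x) (T y) / \<alpha> \<le> \<rho> x y" by (meson dense_ge less_imp_le)
    then show ?thesis using \<alpha> by (simp add: field_simps)
  qed
  have "\<rho> (T x) (T y) \<le> \<alpha> * \<rho> x y" if "\<rho> \<in> F" "(x, y) \<in> undirected E" for \<rho> x y
    using edge[OF that(1), of x y] edge[OF that(1), of y x] that(2) bspec[OF assms(1) that(1)]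
    unfolding undirected_def pseudometric_def by auto
  with \<alpha> show ?thesis by (rule that)
qed

lemma banach_contraction_undirected_edge:
  assumes "banach_contraction F UNIV E T" "(x, y) \<in> undirected E"
  shows "(T x, T y) \<in> undirected E"
  using assms by (auto simp: banach_contraction_def undirected_def)

text \<open>Each edge of the path contributes its own length to \<open>c\<close>, and every
  application of \<open>T\<close> shrinks all these lengths by the factor \<alpha>.\<close>

lemma orbit_distance_bound:
  assumes \<rho>: "pseudometric \<rho>" and "0 < \<alpha>"
    and edges: "\<And>x y. (x, y) \<in> R \<Longrightarrow> (T x, T y) \<in> R"
    and contr: "\<And>x y. (x, y) \<in> R \<Longrightarrow> \<rho> (T x) (T y) \<le> \<alpha> * \<rho> x y"
    and "(x, y) \<in> R\<^sup>*"
  shows "\<exists>c\<ge>0. \<forall>n. \<rho> ((T ^^ n) x) ((T ^^ n) y) \<le> \<alpha> ^ n * c"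
  using \<open>(x, y) \<in> R\<^sup>*\<close>
proof induction
  case base
  then show ?case using \<rho> by (auto simp: pseudometric_def)
next
  case (step y z)
  \<comment> \<open>Edge membership is carried along because \<open>contr\<close> applies only to
    edges.\<close>
  have iter: "((T ^^ n) y, (T ^^ n) z) \<in> R \<and>
      \<rho> ((T ^^ n) y) ((T ^^ n) z) \<le> \<alpha> ^ n * \<rho> y z" for n
  proof (induction n)
    case 0
    then show ?case using step.hyps by simp
  next
    case (Suc n)
    then have "\<rho> ((T ^^ Suc n) y) ((T ^^ Suc n) z) \<le> \<alpha> * \<rho> ((T ^^ n) y) ((T ^^ n) z)"
      using contr by simp
    also have "\<dots> \<le> \<alpha> * (\<alpha> ^ n * \<rho> y z)"
      using Suc \<open>0 < \<alpha>\<close> by (intro mult_left_mono) auto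
    finally show ?case using Suc edges by (simp add: mult.assoc)
  qed
  obtain c where c: "0 \<le> c" "\<And>n. \<rho> ((T ^^ n) x) ((T ^^ n) y) \<le> \<alpha> ^ n * c"
    using step.IH by blast
  have "\<rho> ((T ^^ n) x) ((T ^^ n) z) \<le> \<alpha> ^ n * (c + \<rho> y z)" for n
  proof -
    have "\<rho> ((T ^^ n) x) ((T ^^ n) z)
        \<le> \<rho> ((T ^^ n) x) ((T ^^ n) y) + \<rho> ((T ^^ n) y) ((T ^^ n) z)"
      using \<rho> unfolding pseudometric_def by blast
    then show ?thesis using c(2)[of n] iter[of n] by (simp add: distrib_left)
  qed
  moreover have "0 \<le> c + \<rho> y z" using c(1) \<rho> by (simp add: pseudometric_def)
  ultimately show ?case by blast
qed

lemma eventually_geometric_less: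
  fixes \<alpha> c e :: real
  assumes "0 < \<alpha>" "\<alpha> < 1" "0 < e"
  shows "eventually (\<lambda>n. \<alpha> ^ n * c < e) sequentially"
proof -
  have "(\<lambda>n. \<alpha> ^ n * c) \<longlonglongrightarrow> 0"
    using assms by (intro tendsto_mult_left_zero LIMSEQ_realpow_zero) auto
  then show ?thesis using \<open>0 < e\<close> by (rule order_tendstoD)
qed

theorem proposition2:
  fixes F :: "('a::uniform_space \<Rightarrow> 'a \<Rightarrow> real) set"
    and E :: "('a \<times> 'a) set"
    and T :: "'a \<Rightarrow> 'a"
    and x0 :: 'a
  assumes "\<Inter> (entourages :: ('a \<times> 'a) set set) = Id"
    and "F \<noteq> {}"
    and "\<And>\<rho>. \<rho> \<in> F \<Longrightarrow> pseudometric \<rho>"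
    and "generates_uniformity F"
    and "Id \<subseteq> E"
    and "banach_contraction F UNIV E T"
    and "T x0 \<in> component E x0"
  shows "T ` component E x0 \<subseteq> component E x0 \<and>
    banach_contraction F (component E x0) (component_edges E x0) T \<and>
    (\<forall>x\<in>component E x0. \<forall>y\<in>component E x0.
       cauchy_equivalent (\<lambda>n. (T ^^ n) x) (\<lambda>n. (T ^^ n) y))"
proof -
  let ?C = "component E x0"
  note edge = banach_contraction_undirected_edge[OF assms(6)]
  obtain \<alpha> where \<alpha>: "0 < \<alpha>" "\<alpha> < 1"
    and contr: "\<And>\<rho> x y. \<rho> \<in> F \<Longrightarrow> (x, y) \<in> undirected E \<Longrightarrow> \<rho> (T x) (T y) \<le> \<alpha> * \<rho> x y"
  proof (rule banach_contraction_pseudometric[OF _ assms(6)])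
    show "\<forall>\<rho>\<in>F. pseudometric \<rho>" using assms(3) by blast
  qed (rule that)
  have inv: "T x \<in> ?C" if "x \<in> ?C" for x
  proof -
    \<comment> \<open>The image under \<open>T\<close> of a path from \<open>x0\<close> to
      \<open>x\<close>; it is appended to the path from \<open>x0\<close> to \<open>T x0\<close>
      given by hypothesis.\<close>
    have "(T x0, T x) \<in> (undirected E)\<^sup>*"
      using edge that[unfolded mem_component_iff] by (rule rtrancl_image)
    with assms(7) show ?thesis unfolding mem_component_iff by (rule rtrancl_trans)
  qed
  have bc: "banach_contraction F ?C (component_edges E x0) T"
    unfolding banach_contraction_def
  proof (intro conjI exI[of _ \<alpha>] ballI impI)
    fix x y P
    assume P: "P \<in> presentations F" and xy: "x \<in> ?C" "y \<in> ?C"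
      "(x, y) \<in> entourage ?C P \<inter> component_edges E x0"
    \<comment> \<open>The same \<alpha> serves every pseudometric, so a general basic entourage is
      handled one constraint at a time; strictness comes from \<open>\<rho> x y < r\<close>.\<close>
    have "\<rho> (T x) (T y) < \<alpha> * r" if "(\<rho>, r) \<in> set P" for \<rho> r
    proof -
      have "\<rho> (T x) (T y) \<le> \<alpha> * \<rho> x y"
        using P that xy(3) by (intro contr) (auto simp: presentations_def component_edges_def)
      also have "\<dots> < \<alpha> * r" using that xy(3) \<alpha> by (auto simp: entourage_def)
      finally show ?thesis .
    qed
    then show "(T x, T y) \<in> entourage ?C (scale \<alpha> P)"
      using inv xy by (auto simp: entourage_def scale_def)
  qed (use \<alpha> inv edge in \<open>auto simp: component_edges_def\<close>)
  have bound: "\<exists>c\<ge>0. \<forall>n. \<rho> ((T ^^ n) x) ((T ^^ n) y) \<le> \<alpha> ^ n * c"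
    if "\<rho> \<in> F" "x \<in> ?C" "y \<in> ?C" for \<rho> x y
    using assms(3)[OF that(1)] \<alpha>(1) edge contr[OF that(1)] components_joined[OF that(2,3)]
    by (rule orbit_distance_bound)
  have cauchy: "Cauchy (\<lambda>n. (T ^^ n) x)" if x: "x \<in> ?C" for x
  proof (rule CauchyI_pseudometrics[OF assms(4)])
    fix \<rho> and e :: real assume "\<rho> \<in> F" "0 < e"
    \<comment> \<open>Since \<open>(T ^^ n) (T x)\<close> is the next point of the orbit, this
      bounds its consecutive steps geometrically.\<close>
    obtain c where c: "0 \<le> c" "\<And>n. \<rho> ((T ^^ n) x) ((T ^^ n) (T x)) \<le> \<alpha> ^ n * c"
      using bound[OF \<open>\<rho> \<in> F\<close> x inv[OF x]] by blast
    have *: "\<rho> ((T ^^ n) x) ((T ^^ m) x) \<le> \<alpha> ^ n * (c / (1 - \<alpha>))" if "n \<le> m" for n m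
      using geometric_steps_bound[OF assms(3)[OF \<open>\<rho> \<in> F\<close>] \<alpha> c(1), of "\<lambda>n. (T ^^ n) x" n m]
        c(2) that by (simp add: funpow_swap1)
    \<comment> \<open>The bound in \<open>*\<close> does not involve \<open>m\<close>, so one
      \<open>N\<close> serves all later indices.\<close>
    obtain N where "\<And>n. N \<le> n \<Longrightarrow> \<alpha> ^ n * (c / (1 - \<alpha>)) < e"
      using eventually_geometric_less[OF \<alpha> \<open>0 < e\<close>] unfolding eventually_sequentially by blast
    with * show "\<exists>N. \<forall>n m. N \<le> n \<longrightarrow> n \<le> m \<longrightarrow> \<rho> ((T ^^ n) x) ((T ^^ m) x) < e"
      by (meson order_le_less_trans)
  qed (rule assms(3))
  have "filterlim (\<lambda>n. ((T ^^ n) x, (T ^^ n) y)) uniformity sequentially"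
    if xy: "x \<in> ?C" "y \<in> ?C" for x y
    unfolding generates_uniformity_filterlim_iff[OF assms(4)] fst_conv snd_conv
  proof (intro ballI allI impI)
    fix \<rho> and r :: real assume "\<rho> \<in> F" "0 < r"
    \<comment> \<open>Here \<open>c\<close> may depend on \<rho>, since each pseudometric is tested
      separately.\<close>
    obtain c where c: "\<And>n. \<rho> ((T ^^ n) x) ((T ^^ n) y) \<le> \<alpha> ^ n * c"
      using bound[OF \<open>\<rho> \<in> F\<close> xy] by blast
    from eventually_geometric_less[OF \<alpha> \<open>0 < r\<close>, of c]
    show "eventually (\<lambda>n. \<rho> ((T ^^ n) x) ((T ^^ n) y) < r) sequentially"
      by (rule eventually_mono) (rule order_le_less_trans[OF c])
  qed
  with inv bc cauchy show ?thesis
    by (auto intro!: cauchy_equivalentI)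
qed

end
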